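(* Let $M$, $P$, $K$ be real symmetric positive semidefinite $m\times m$ matrices of which $M$ and $K$ are invertible. Let $F$ be a real $m\times k$ matrix and let $Q_1,Q_2$ be real $k\times m$ matrices. Then the following holds. (1) The second order coupled system of ODEs $$M z''(t)+Pz'(t)+Kz(t)=Fu(t),\qquad y(t)=Q_1z(t)+Q_2z'(t),\qquad t\in I,$$ defines a linear system $\Sigma_i$ (with state space of dimension $n=2m$) by $$x'(t)=\begin{bmatrix}0&K^{1/2}M^{-1/2}\\ -M^{-1/2}K^{1/2}&-M^{-1/2}PM^{-1/2}\end{bmatrix}x(t)+\frac1{\sqrt2}\begin{bmatrix}0\\ M^{-1/2}F\end{bmatrix}u(t),$$ $$y(t)=\sqrt2\begin{bmatrix}Q_1K^{-1/2}&Q_2M^{-1/2}\end{bmatrix}x(t),\qquad t\in I,$$ where $x(t):=\frac1{\sqrt2}\begin{bmatrix}K^{1/2}z(t)\\ M^{1/2}z'(t)\end{bmatrix}$. (2) $\Sigma_i$ is impedance passive if and only if $Q_1=0$ and $Q_2=\frac12F^T$. (3) $\Sigma_i$ is impedance conservative if and only if $P=Q_1=0$ and $Q_2=\frac12F^T$.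
   Context: All matrices and signals are real and finite-dimensional; norms and inner products are Euclidean; $I\subset\mathbb R$ is an interval; signals are assumed sufficiently smooth for classical solvability. A linear system $\Sigma=\begin{bmatrix}A&B\\ C&D\end{bmatrix}$ is the quadruple of matrices in the equations $x'(t)=Ax(t)+Bu(t)$, $y(t)=Cx(t)+Du(t)$, $t\in I$, where $u$ (input) and $y$ (output) have the same dimension. $\Sigma$ is impedance passive if all functions $u,x,y$ satisfying these equations satisfy $\frac{d}{dt}\|x(t)\|^2\le 2\langle u(t),y(t)\rangle$ for all $t\in I$; it is impedance conservative if this always holds as an equality. *)

theory Defs
  imports "HOL-Analysis.Analysis"
begin

definition psd :: "real^'n^'n \<Rightarrow> bool" where
  "psd S \<longleftrightarrow> transpose S = S \<and> (\<forall>x. 0 \<le> x \<bullet> (S *v x))"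

text \<open>The principal square root: the unique symmetric positive semidefinite
  matrix with square \<open>S\<close>; meaningful only for \<open>S\<close> itself symmetric positive semidefinite.\<close>

definition mat_sqrt :: "real^'n^'n \<Rightarrow> real^'n^'n" where
  "mat_sqrt S = (THE R. psd R \<and> R ** R = S)"

definition mat_inv_sqrt :: "real^'n^'n \<Rightarrow> real^'n^'n" where
  "mat_inv_sqrt S = matrix_inv (mat_sqrt S)"

text \<open>Block vectors and matrices are indexed by a sum type. As a matrix is the vector of
  its rows, \<open>vstack\<close> serves both for column vectors and for matrices.\<close>

definition vstack :: "'a^'m \<Rightarrow> 'a^'n \<Rightarrow> 'a^('m + 'n)" where
  "vstack v w = (\<chi> i. case i of Inl j \<Rightarrow> v $ j | Inr j \<Rightarrow> w $ j)"

definition hstack :: "'a^'m^'k \<Rightarrow> 'a^'n^'k \<Rightarrow> 'a^('m + 'n)^'k" where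
  "hstack S T = (\<chi> i. vstack (S $ i) (T $ i))"

text \<open>Time derivative along \<open>I\<close>; one-sided at an endpoint belonging to \<open>I\<close>.\<close>

definition tderiv :: "real set \<Rightarrow> (real \<Rightarrow> 'a::real_normed_vector) \<Rightarrow> real \<Rightarrow> 'a" where
  "tderiv I f t = vector_derivative f (at t within I)"

record ('n, 'k) linear_system =
  sysA :: "real^'n^'n"
  sysB :: "real^'k^'n"
  sysC :: "real^'n^'k"
  sysD :: "real^'k^'k"

text \<open>Classical solutions: continuous input and differentiable (hence \<open>C\<^sup>1\<close>) state.\<close>

definition system_solution ::
  "real set \<Rightarrow> ('n::finite, 'k::finite) linear_system \<Rightarrow>
    (real \<Rightarrow> real^'k) \<Rightarrow> (real \<Rightarrow> real^'n) \<Rightarrow> (real \<Rightarrow> real^'k) \<Rightarrow> bool" where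
  "system_solution I \<Sigma> u x y \<longleftrightarrow>
     continuous_on I u \<and> x differentiable_on I \<and>
     (\<forall>t\<in>I. tderiv I x t = sysA \<Sigma> *v x t + sysB \<Sigma> *v u t \<and>
            y t = sysC \<Sigma> *v x t + sysD \<Sigma> *v u t)"

definition impedance_passive ::
  "real set \<Rightarrow> ('n::finite, 'k::finite) linear_system \<Rightarrow> bool" where
  "impedance_passive I \<Sigma> \<longleftrightarrow>
     (\<forall>u x y. system_solution I \<Sigma> u x y \<longrightarrow>
        (\<forall>t\<in>I. tderiv I (\<lambda>s. (norm (x s))\<^sup>2) t \<le> 2 * (u t \<bullet> y t)))"

definition impedance_conservative ::
  "real set \<Rightarrow> ('n::finite, 'k::finite) linear_system \<Rightarrow> bool" where
  "impedance_conservative I \<Sigma> \<longleftrightarrow>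
     (\<forall>u x y. system_solution I \<Sigma> u x y \<longrightarrow>
        (\<forall>t\<in>I. tderiv I (\<lambda>s. (norm (x s))\<^sup>2) t = 2 * (u t \<bullet> y t)))"

definition second_order_solution ::
  "real set \<Rightarrow> real^'m^'m \<Rightarrow> real^'m^'m \<Rightarrow> real^'m^'m \<Rightarrow> real^'k^'m \<Rightarrow>
    real^'m^'k \<Rightarrow> real^'m^'k \<Rightarrow>
    (real \<Rightarrow> real^'k) \<Rightarrow> (real \<Rightarrow> real^'m) \<Rightarrow> (real \<Rightarrow> real^'k) \<Rightarrow> bool" where
  "second_order_solution I M P K F Q1 Q2 u z y \<longleftrightarrow>
     continuous_on I u \<and> z differentiable_on I \<and> tderiv I z differentiable_on I \<and>
     (\<forall>t\<in>I. M *v tderiv I (tderiv I z) t + P *v tderiv I z t + K *v z t = F *v u t \<and>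
            y t = Q1 *v z t + Q2 *v tderiv I z t)"

definition second_order_state ::
  "real set \<Rightarrow> real^'m^'m \<Rightarrow> real^'m^'m \<Rightarrow> (real \<Rightarrow> real^'m) \<Rightarrow> real \<Rightarrow> real^('m + 'm)" where
  "second_order_state I M K z t =
     (1 / sqrt 2) *\<^sub>R vstack (mat_sqrt K *v z t) (mat_sqrt M *v tderiv I z t)"

definition second_order_system ::
  "real^'m^'m \<Rightarrow> real^'m^'m \<Rightarrow> real^'m^'m \<Rightarrow> real^'k^'m \<Rightarrow>
    real^'m^'k \<Rightarrow> real^'m^'k \<Rightarrow> ('m::finite + 'm, 'k::finite) linear_system" where
  "second_order_system M P K F Q1 Q2 =
     \<lparr> sysA = vstack
         (hstack 0 (mat_sqrt K ** mat_inv_sqrt M))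
         (hstack (- (mat_inv_sqrt M ** mat_sqrt K))
                 (- (mat_inv_sqrt M ** P ** mat_inv_sqrt M))),
       sysB = (1 / sqrt 2) *\<^sub>R vstack 0 (mat_inv_sqrt M ** F),
       sysC = sqrt 2 *\<^sub>R hstack (Q1 ** mat_inv_sqrt K) (Q2 ** mat_inv_sqrt M),
       sysD = 0 \<rparr>"

end

theory Submission
  imports Defs
begin

text \<open>The state is scaled so that \<open>\<parallel>x\<parallel>\<^sup>2\<close> is the mechanical energy: with \<open>a = z\<close> and \<open>b = z'\<close>,
  \<open>x = (K^(1/2) a, M^(1/2) b) / \<surd>2\<close> has \<open>\<parallel>x\<parallel>\<^sup>2 = (a \<bullet> K a + b \<bullet> M b) / 2\<close>. As both square roots are invertible,
  \<open>(z, z') \<mapsto> x\<close> is a linear change of coordinates, and the first order system is the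
  second order equation written in these coordinates (\<open>second_order_solution_iff_system_solution\<close>,
  \<open>system_solution_imp_second_order\<close>). The square roots themselves come from the spectral
  theorem (\<open>selfadjoint_orthonormal_eigenbasis\<close>), their uniqueness being needed to make sense of
  \<^const>\<open>mat_sqrt\<close>.

  Passivity and conservativity quantify over trajectories. Since \<open>x' = A x + B u\<close> with constant
  input can be solved through any point (\<open>linear_ode_solution_exists\<close>), they amount to the pointwise
  comparison of \<open>x \<bullet> (A x + B u)\<close> and \<open>u \<bullet> (C x + D u)\<close> for all vectors \<open>x\<close>, \<open>u\<close>
  (\<open>energy_balance_pointwise\<close>). In the coordinates \<open>a\<close>, \<open>b\<close> the skew-symmetric part of \<open>A\<close> drops
  out and the comparison is between
  \<open>(b \<bullet> F u - b \<bullet> P b) / 2\<close> and \<open>u \<bullet> (Q1 a + Q2 b)\<close> (\<open>second_order_power_balance\<close>).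
  Scaling \<open>a\<close> and \<open>u\<close> separately shows that the inequality forces \<open>Q1 = 0\<close> and \<open>Q2 = F\<^sup>T / 2\<close>;
  what is left is \<open>- (b \<bullet> P b) / 2 \<le> 0\<close>, with equality for all \<open>b\<close> exactly when \<open>P = 0\<close>.\<close>

section \<open>Spectral theorem and principal square roots\<close>

text \<open>If \<open>f v \<noteq> 0\<close>, moving from \<open>v\<close> a short way along \<open>- f v\<close> changes the form by
  \<open>- 2 a \<parallel>f v\<parallel>\<^sup>2 + O(a\<^sup>2)\<close>, hence makes it negative. Restricting the hypothesis to an invariant
  subspace lets the induction over subspaces in the spectral theorem use it.\<close>

lemma psd_form_zero_imp_kernel:
  fixes f :: "'a::real_inner \<Rightarrow> 'a"
  assumes "linear f" and sym: "\<And>x y. f x \<bullet> y = x \<bullet> f y"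
    and "subspace W" and inv: "f ` W \<subseteq> W"
    and nonneg: "\<And>x. x \<in> W \<Longrightarrow> 0 \<le> x \<bullet> f x"
    and "v \<in> W" and zero: "v \<bullet> f v = 0"
  shows "f v = 0"
proof (rule ccontr)
  interpret f: linear f by fact
  \<comment> \<open>This step length keeps the second order term below the first order gain, also for \<open>c = 0\<close>.\<close>
  define n c a where "n = f v \<bullet> f v" and "c = f v \<bullet> f (f v)" and "a = n / (1 + c)"
  assume "f v \<noteq> 0"
  then have "n > 0" by (simp add: n_def)
  have fv: "f v \<in> W" using inv \<open>v \<in> W\<close> by blast
  then have "c \<ge> 0" using nonneg by (simp add: c_def)
  have "v - a *\<^sub>R f v \<in> W"
    using fv \<open>v \<in> W\<close> \<open>subspace W\<close> by (simp add: subspace_diff subspace_scale)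
  then have "0 \<le> (v - a *\<^sub>R f v) \<bullet> f (v - a *\<^sub>R f v)" by (rule nonneg)
  also have "\<dots> = a * (a * c - 2 * n)"
    using zero sym[of v "f v"]
    by (simp add: f.diff f.scaleR n_def c_def inner_diff_left inner_diff_right algebra_simps)
  also have "a * c - 2 * n = - n * (c + 2) / (1 + c)"
    using \<open>c \<ge> 0\<close> by (simp add: a_def field_simps)
  also have "a * (- n * (c + 2) / (1 + c)) < 0"
    using \<open>n > 0\<close> \<open>c \<ge> 0\<close> by (simp add: a_def mult_pos_neg divide_neg_pos)
  finally show False by simp
qed

text \<open>The eigenvector is a maximiser \<open>v\<close> of the Rayleigh quotient, with value \<open>\<mu>\<close>, on the unit sphere of
  \<open>W\<close>: the form of \<open>\<mu> - f\<close> is then nonnegative on \<open>W\<close> and vanishes at \<open>v\<close>, so \<open>\<mu> - f\<close>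
  annihilates \<open>v\<close>.\<close>

lemma selfadjoint_eigenvector_exists:
  fixes f :: "'a::euclidean_space \<Rightarrow> 'a"
  assumes "linear f" and sym: "\<And>x y. f x \<bullet> y = x \<bullet> f y"
    and "subspace W" and inv: "f ` W \<subseteq> W" and "W \<noteq> {0}"
  obtains v \<mu> where "v \<in> W" "norm v = 1" "f v = \<mu> *\<^sub>R v"
proof -
  interpret f: linear f by fact
  have normalize: "x /\<^sub>R norm x \<in> sphere 0 1 \<inter> W" if "x \<in> W" "x \<noteq> 0" for x
    using that \<open>subspace W\<close> by (simp add: subspace_scale)
  have "0 \<in> W" using \<open>subspace W\<close> by (rule subspace_0)
  then obtain x where "x \<in> W" "x \<noteq> 0" using \<open>W \<noteq> {0}\<close> by blast
  then have "sphere 0 1 \<inter> W \<noteq> {}" using normalize by blast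
  moreover have "compact (sphere 0 1 \<inter> W)"
    using \<open>subspace W\<close> by (intro compact_Int_closed closed_subspace) auto
  moreover have "continuous_on (sphere 0 1 \<inter> W) (\<lambda>x. x \<bullet> f x)"
    using linear_continuous_on_compose[OF continuous_on_id \<open>linear f\<close>]
    by (intro continuous_on_inner) auto
  ultimately obtain v where v: "v \<in> sphere 0 1 \<inter> W"
    and max: "\<And>x. x \<in> sphere 0 1 \<inter> W \<Longrightarrow> x \<bullet> f x \<le> v \<bullet> f v"
    using continuous_attains_sup by metis
  define \<mu> where "\<mu> = v \<bullet> f v"
  define g where "g x = \<mu> *\<^sub>R x - f x" for x
  have "v \<bullet> v = 1" using v by (simp add: dot_square_norm)
  have "g v = 0"
  proof (rule psd_form_zero_imp_kernel[where f = g and v = v and W = W])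
    show "linear g"
      by (auto intro!: linearI simp: g_def f.add f.scaleR algebra_simps)
    show "g x \<bullet> y = x \<bullet> g y" for x y
      by (simp add: g_def inner_diff_left inner_diff_right sym)
    show "g ` W \<subseteq> W"
      using inv \<open>subspace W\<close> by (auto simp: g_def intro!: subspace_diff subspace_scale)
    show "0 \<le> x \<bullet> g x" if "x \<in> W" for x
    proof (cases "x = 0")
      case False
      have "(x \<bullet> f x) / (norm x)\<^sup>2 \<le> \<mu>"
        using max[OF normalize[OF that False]]
        by (simp add: f.scaleR \<mu>_def power2_eq_square divide_inverse mult_ac)
      then show ?thesis
        using False by (simp add: g_def inner_diff_right dot_square_norm field_simps)
    qed simp
    show "v \<bullet> g v = 0"
      using \<open>v \<bullet> v = 1\<close> by (simp add: g_def inner_diff_right \<mu>_def)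
  qed (use v \<open>subspace W\<close> in auto)
  then show thesis using v by (intro that[of v \<mu>]) (auto simp: g_def)
qed

text \<open>The spectral theorem. The orthogonal complement of an eigenvector inside an invariant subspace
  is invariant again because \<open>f\<close> is self-adjoint, so eigenvectors can be split off one at a
  time.\<close>

lemma selfadjoint_orthonormal_eigenbasis:
  fixes f :: "'a::euclidean_space \<Rightarrow> 'a"
  assumes "linear f" and sym: "\<And>x y. f x \<bullet> y = x \<bullet> f y"
  shows "subspace W \<Longrightarrow> f ` W \<subseteq> W \<Longrightarrow>
    \<exists>B. finite B \<and> pairwise orthogonal B \<and> (\<forall>b\<in>B. norm b = 1) \<and> span B = W \<and>
        (\<forall>b\<in>B. \<exists>\<mu>. f b = \<mu> *\<^sub>R b)"
proof (induction "dim W" arbitrary: W rule: less_induct)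
  case less
  show ?case
  proof (cases "W = {0}")
    case True
    then show ?thesis by (intro exI[of _ "{}"]) auto
  next
    case False
    obtain v \<mu> where v: "v \<in> W" "norm v = 1" "f v = \<mu> *\<^sub>R v"
      using selfadjoint_eigenvector_exists[OF assms less.prems False] by metis
    have "v \<bullet> v = 1" using v by (simp add: dot_square_norm)
    define U where "U = {x \<in> W. v \<bullet> x = 0}"
    have "subspace U"
      using less.prems(1) by (auto simp: U_def subspace_def inner_add_right)
    moreover have "f ` U \<subseteq> U"
    proof
      fix y assume "y \<in> f ` U"
      then obtain x where x: "x \<in> W" "v \<bullet> x = 0" "y = f x" by (auto simp: U_def)
      then have "v \<bullet> y = 0" using v sym[of v x] by simp
      then show "y \<in> U" using x less.prems(2) by (auto simp: U_def)
    qed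
    moreover have "dim U < dim W"
    proof (rule dim_psubset)
      have "U \<subseteq> W" "v \<notin> U" using \<open>v \<bullet> v = 1\<close> by (auto simp: U_def)
      then show "span U \<subset> span W"
        using v(1) less.prems(1) \<open>subspace U\<close> by (auto simp: span_eq_iff[THEN iffD2])
    qed
    ultimately obtain B where B: "finite B" "pairwise orthogonal B" "\<forall>b\<in>B. norm b = 1"
      "span B = U" "\<forall>b\<in>B. \<exists>\<mu>. f b = \<mu> *\<^sub>R b"
      using less.hyps[of U] by blast
    have "B \<subseteq> U" using B(4) span_superset by blast
    have "span (insert v B) = W"
    proof
      show "span (insert v B) \<subseteq> W"
        using v(1) \<open>B \<subseteq> U\<close> less.prems(1) by (intro span_minimal) (auto simp: U_def)
      show "W \<subseteq> span (insert v B)"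
      proof
        fix x assume "x \<in> W"
        then have "x - (v \<bullet> x) *\<^sub>R v \<in> U"
          using v(1) less.prems(1) \<open>v \<bullet> v = 1\<close>
          by (auto simp: U_def inner_diff_right intro!: subspace_diff subspace_scale)
        then show "x \<in> span (insert v B)" using B(4) by (auto simp: span_insert)
      qed
    qed
    moreover have "pairwise orthogonal (insert v B)"
      using B(2) \<open>B \<subseteq> U\<close>
      by (auto simp: pairwise_insert U_def orthogonal_def inner_commute)
    ultimately show ?thesis
      using B v by (intro exI[of _ "insert v B"]) auto
  qed
qed

lemma psd_inner: "psd R \<Longrightarrow> (R *v x) \<bullet> y = x \<bullet> (R *v y)"
  by (metis psd_def dot_lmul_matrix vector_transpose_matrix)

lemma psd_kernel:
  assumes "psd R" and "x \<bullet> (R *v x) = 0"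
  shows "R *v x = 0"
  using assms psd_form_zero_imp_kernel[of "(*v) R" UNIV x]
  by (auto simp: psd_inner matrix_vector_mul_linear psd_def)

text \<open>The root keeps an orthonormal eigenbasis and replaces each eigenvalue by its square root.\<close>

lemma psd_sqrt_exists:
  fixes S :: "real^'n^'n"
  assumes "psd S"
  shows "\<exists>R. psd R \<and> R ** R = S"
proof -
  obtain B where B: "finite B" "pairwise orthogonal B" "\<forall>b\<in>B. norm b = 1"
    "span B = (UNIV :: (real^'n) set)" and eig: "\<forall>b\<in>B. \<exists>\<mu>. S *v b = \<mu> *\<^sub>R b"
    using selfadjoint_orthonormal_eigenbasis[of "(*v) S" UNIV] psd_inner[OF assms]
    by (auto simp: matrix_vector_mul_linear)
  define \<mu> where "\<mu> b = b \<bullet> (S *v b)" for b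
  have \<mu>: "S *v b = \<mu> b *\<^sub>R b" "\<mu> b \<ge> 0" if "b \<in> B" for b
    using that eig B(3) assms by (auto simp: \<mu>_def psd_def dot_square_norm)
  have expand: "(\<Sum>b\<in>B. (x \<bullet> b) *\<^sub>R b) = x" for x
    using B by (intro orthonormal_basis_expand) auto
  define r where "r x = (\<Sum>b\<in>B. (sqrt (\<mu> b) * (x \<bullet> b)) *\<^sub>R b)" for x
  have "linear r"
    by (auto intro!: linearI simp: r_def inner_add_left algebra_simps sum.distrib scaleR_right.sum)
  then have R: "matrix r *v x = r x" for x by (simp add: matrix_works)
  have r_dot: "r x \<bullet> y = (\<Sum>b\<in>B. sqrt (\<mu> b) * (x \<bullet> b) * (y \<bullet> b))" for x y
    unfolding r_def inner_sum_left by (intro sum.cong) (auto simp: inner_commute)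
  have r_sym: "r x \<bullet> y = x \<bullet> r y" for x y
    by (subst inner_commute[of x]) (simp add: r_dot mult_ac)
  have "psd (matrix r)"
    unfolding psd_def
  proof
    show "transpose (matrix r) = matrix r"
      unfolding matrix_eq
    proof
      fix x
      have "(transpose (matrix r) *v x) \<bullet> y = (matrix r *v x) \<bullet> y" for y
        by (metis R dot_lmul_matrix r_sym transpose_matrix_vector)
      then show "transpose (matrix r) *v x = matrix r *v x" by (metis vector_eq_rdot)
    qed
    show "\<forall>x. 0 \<le> x \<bullet> (matrix r *v x)"
      using \<mu>(2) by (auto simp: R inner_commute[of _ "r _"] r_dot mult.assoc intro!: sum_nonneg)
  qed
  moreover have "matrix r ** matrix r = S"
    unfolding matrix_eq
  proof
    fix x
    have r_eig: "r b = sqrt (\<mu> b) *\<^sub>R b" if "b \<in> B" for b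
    proof -
      have "r b = (\<Sum>c\<in>B. if c = b then sqrt (\<mu> b) *\<^sub>R b else 0)"
        unfolding r_def using B that
        by (intro sum.cong) (auto simp: pairwise_def orthogonal_def dot_square_norm)
      then show ?thesis using B(1) that by simp
    qed
    have "r (r x) = (\<Sum>b\<in>B. (sqrt (\<mu> b) * (r x \<bullet> b)) *\<^sub>R b)" by (simp add: r_def)
    also have "\<dots> = (\<Sum>b\<in>B. (x \<bullet> b) *\<^sub>R (S *v b))"
      using \<mu> by (intro sum.cong) (auto simp: r_sym r_eig)
    also have "\<dots> = S *v (\<Sum>b\<in>B. (x \<bullet> b) *\<^sub>R b)"
      by (simp add: linear_sum[OF matrix_vector_mul_linear] linear_scale[OF matrix_vector_mul_linear])
    finally show "(matrix r ** matrix r) *v x = S *v x"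
      by (simp add: R matrix_vector_mul_assoc[symmetric] expand)
  qed
  ultimately show ?thesis by blast
qed

text \<open>On an eigenvector \<open>b\<close> of \<open>R - Q\<close> with eigenvalue \<open>\<mu>\<close>, the equality \<open>\<parallel>R b\<parallel> = \<parallel>Q b\<parallel>\<close> factors as
  \<open>\<mu> (b \<bullet> R b + b \<bullet> Q b) = 0\<close>. Either \<open>\<mu> = 0\<close>, or both forms vanish at \<open>b\<close> and \<open>R b = Q b = 0\<close>.
  So \<open>R - Q\<close> annihilates an eigenbasis.\<close>

lemma psd_sqrt_unique:
  fixes R Q :: "real^'n^'n"
  assumes "psd R" "psd Q" and eq: "R ** R = Q ** Q"
  shows "R = Q"
proof -
  obtain B where B: "span B = (UNIV :: (real^'n) set)" "\<forall>b\<in>B. \<exists>\<mu>. (R - Q) *v b = \<mu> *\<^sub>R b"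
    using selfadjoint_orthonormal_eigenbasis[of "(*v) (R - Q)" UNIV] assms(1,2)
    by (auto simp: matrix_vector_mult_diff_rdistrib inner_diff_left inner_diff_right psd_inner)
  have "(R - Q) *v b = 0" if b: "b \<in> B" for b
  proof -
    obtain \<mu> where \<mu>: "(R - Q) *v b = \<mu> *\<^sub>R b" using B b by blast
    have "(R *v b) \<bullet> (R *v b) = (Q *v b) \<bullet> (Q *v b)"
      using assms eq by (metis matrix_vector_mul_assoc psd_inner)
    then have "((R - Q) *v b) \<bullet> (R *v b + Q *v b) = 0"
      by (simp add: matrix_vector_mult_diff_rdistrib inner_diff_left inner_add_right inner_diff_right inner_commute)
    then have "\<mu> = 0 \<or> b \<bullet> (R *v b) + b \<bullet> (Q *v b) = 0"
      by (simp add: \<mu> flip: inner_add_right)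
    then show ?thesis
    proof
      assume "b \<bullet> (R *v b) + b \<bullet> (Q *v b) = 0"
      moreover have "b \<bullet> (R *v b) \<ge> 0" "b \<bullet> (Q *v b) \<ge> 0" using assms by (auto simp: psd_def)
      ultimately have "R *v b = 0" "Q *v b = 0"
        using assms by (auto intro!: psd_kernel)
      then show ?thesis by (simp add: matrix_vector_mult_diff_rdistrib)
    qed (simp add: \<mu>)
  qed
  then have "(R - Q) *v x = 0" for x
    using linear_eq_0_on_span[of "(*v) (R - Q)" B x] B(1) by (simp add: matrix_vector_mul_linear)
  then show ?thesis
    by (simp add: matrix_eq matrix_vector_mult_diff_rdistrib)
qed

lemma mat_sqrt:
  assumes "psd S"
  shows "psd (mat_sqrt S)" "mat_sqrt S ** mat_sqrt S = S"
proof -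
  have "\<exists>!R. psd R \<and> R ** R = S"
    using psd_sqrt_exists[OF assms] psd_sqrt_unique by blast
  then have "psd (mat_sqrt S) \<and> mat_sqrt S ** mat_sqrt S = S"
    unfolding mat_sqrt_def by (rule theI')
  then show "psd (mat_sqrt S)" "mat_sqrt S ** mat_sqrt S = S" by auto
qed

text \<open>Stated on vectors, because these cancellations are the form in which the inverse root is used
  everywhere below.\<close>

lemma mat_inv_sqrt:
  fixes S :: "real^'n^'n"
  assumes "psd S" and "invertible S"
  shows "mat_sqrt S *v (mat_inv_sqrt S *v x) = x" "mat_inv_sqrt S *v (mat_sqrt S *v x) = x"
proof -
  have "det (mat_sqrt S) \<noteq> 0"
    using assms mat_sqrt(2)[OF assms(1)] by (metis det_mul invertible_det_nz mult_eq_0_iff)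
  then have "invertible (mat_sqrt S)" by (simp add: invertible_det_nz)
  then have "mat_sqrt S ** mat_inv_sqrt S = mat 1 \<and> mat_inv_sqrt S ** mat_sqrt S = mat 1"
    unfolding mat_inv_sqrt_def invertible_def matrix_inv_def by (rule someI_ex)
  then show "mat_sqrt S *v (mat_inv_sqrt S *v x) = x" "mat_inv_sqrt S *v (mat_sqrt S *v x) = x"
    by (auto simp: matrix_vector_mul_assoc)
qed

section \<open>Linear initial value problems\<close>

text \<open>The Taylor coefficients at \<open>t0\<close> are forced: \<open>w 0 = x0\<close>, \<open>w 1 = A x0 + b\<close>, and
  \<open>w (k + 1) = A (w k)\<close> from then on. They grow at most geometrically, so each component of
  \<open>\<Sum>k. w k (t - t0)^k / k!\<close> is an everywhere convergent power series, to be differentiated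
  termwise. A constant \<open>b\<close> is enough to realise a constant input.\<close>

lemma linear_ode_solution_exists:
  fixes A :: "real^'n^'n" and x0 b :: "real^'n"
  obtains x where "x t0 = x0" "\<And>t. (x has_vector_derivative A *v x t + b) (at t)"
proof -
  define w where "w k = (if k = 0 then x0 else (((*v) A) ^^ (k - 1)) (A *v x0 + b))" for k
  have w_0: "w 0 = x0" and w_Suc: "w (Suc k) = A *v w k + (if k = 0 then b else 0)" for k
    by (cases k; simp add: w_def)+
  \<comment> \<open>Adding 1 makes the powers of \<open>C\<close> increasing, which absorbs the index shift at \<open>w 1\<close>.\<close>
  define C where "C = onorm ((*v) A) + 1"
  define D where "D = norm x0 + norm (A *v x0 + b)"
  have "C \<ge> 1" by (simp add: C_def onorm_pos_le)
  have A_bound: "norm (A *v v) \<le> C * norm v" for v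
  proof -
    have "norm (A *v v) \<le> onorm ((*v) A) * norm v"
      by (intro onorm) simp
    then show ?thesis using norm_ge_zero[of v] unfolding C_def distrib_right by linarith
  qed
  have bound: "norm (w k) \<le> D * C ^ k" for k
  proof (cases k)
    case (Suc j)
    have "norm (w (Suc i)) \<le> D * C ^ i" for i
    proof (induction i)
      case (Suc i)
      have "norm (w (Suc (Suc i))) \<le> C * norm (w (Suc i))"
        using A_bound by (simp add: w_Suc[of "Suc i"])
      also have "\<dots> \<le> C * (D * C ^ i)" using Suc \<open>C \<ge> 1\<close> by (intro mult_left_mono) auto
      finally show ?case by (simp add: mult_ac)
    qed (simp add: w_Suc w_0 D_def)
    also have "D * C ^ j \<le> D * C ^ Suc j"
      using \<open>C \<ge> 1\<close> by (intro mult_left_mono power_increasing) (auto simp: D_def)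
    finally show ?thesis using Suc by simp
  qed (simp add: w_0 D_def)
  define c where "c i k = w k $ i / fact k" for i k
  have summable: "summable (\<lambda>k. c i k * s ^ k)" for i s
  proof (rule summable_comparison_test')
    show "summable (\<lambda>k. D * (inverse (fact k) * (C * \<bar>s\<bar>) ^ k))"
      by (intro summable_mult summable_exp)
    show "norm (c i k * s ^ k) \<le> D * (inverse (fact k) * (C * \<bar>s\<bar>) ^ k)" for k
    proof -
      have "norm (c i k * s ^ k) = \<bar>w k $ i\<bar> * (\<bar>s\<bar> ^ k / fact k)"
        by (simp add: c_def abs_mult power_abs)
      also have "\<dots> \<le> (D * C ^ k) * (\<bar>s\<bar> ^ k / fact k)"
        using bound[of k] component_le_norm_cart[of "w k" i] by (intro mult_right_mono) auto
      finally show ?thesis by (simp add: power_mult_distrib field_simps)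
    qed
  qed
  define x where "x t = (\<chi> i. \<Sum>k. c i k * (t - t0) ^ k)" for t
  have diffs: "(\<Sum>k. diffs (c i) k * s ^ k) = (A *v (\<chi> j. \<Sum>k. c j k * s ^ k) + b) $ i" for i s
  proof -
    have "diffs (c i) k * s ^ k = (\<Sum>j\<in>UNIV. A $ i $ j * (c j k * s ^ k)) + (if k = 0 then b $ i else 0)" for k
    proof -
      have "diffs (c i) k = w (Suc k) $ i / fact k"
        by (simp add: diffs_def c_def del: of_nat_Suc)
      also have "\<dots> = (\<Sum>j\<in>UNIV. A $ i $ j * c j k) + (if k = 0 then b $ i else 0)"
        by (simp add: w_Suc matrix_vector_mult_def c_def sum_divide_distrib add_divide_distrib)
      finally show ?thesis
        by (simp add: distrib_right sum_distrib_right mult.assoc)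
    qed
    then have "(\<lambda>k. diffs (c i) k * s ^ k) sums
        ((\<Sum>j\<in>UNIV. A $ i $ j * (\<Sum>k. c j k * s ^ k)) + b $ i)"
      using sums_single[of 0 "\<lambda>_. b $ i"]
      by (auto intro!: sums_add sums_sum sums_mult summable_sums summable)
    then show ?thesis by (simp add: sums_iff matrix_vector_mult_def)
  qed
  have "x t0 $ i = c i 0" for i
    by (simp add: x_def powser_zero)
  then have "x t0 = x0"
    by (simp add: vec_eq_iff c_def w_0)
  moreover have "(x has_vector_derivative A *v x t + b) (at t)" for t
    unfolding has_vector_derivative_def
  proof (subst has_derivative_componentwise_within, rule ballI)
    fix e :: "real^'n" assume "e \<in> Basis"
    then obtain i where e: "e = axis i 1" by (auto simp: Basis_vec_def)
    have "((\<lambda>s. \<Sum>k. c i k * s ^ k) has_field_derivative (\<Sum>k. diffs (c i) k * (t - t0) ^ k)) (at (t - t0))"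
      by (rule termdiffs_strong_converges_everywhere[OF summable])
    from DERIV_chain2[where g = "\<lambda>t. t - t0" and x = t and s = UNIV and Db = 1, OF this]
      DERIV_diff[OF DERIV_ident DERIV_const[of t0]]
    have "((\<lambda>t. x t $ i) has_real_derivative (A *v x t + b) $ i) (at t)"
      by (simp add: x_def diffs)
    then show "((\<lambda>s. x s \<bullet> e) has_derivative (\<lambda>h. (h *\<^sub>R (A *v x t + b)) \<bullet> e)) (at t)"
      by (simp add: e inner_axis has_field_derivative_def mult_commute_abs)
  qed
  ultimately show thesis by (rule that)
qed

section \<open>Solutions of linear systems and their energy\<close>

lemma interval_point_not_isolated:
  fixes I :: "real set"
  assumes "is_interval I" and "interior I \<noteq> {}" and "t \<in> I"
  shows "at t within I \<noteq> bot"
proof -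
  have "I \<noteq> {s}" for s using assms(2) by auto
  then show ?thesis
    using connected_imp_perfect[of I t] assms
    by (simp add: trivial_limit_within is_interval_connected)
qed

lemma tderiv_eqI:
  assumes "is_interval I" and "interior I \<noteq> {}" and "t \<in> I"
    and "(f has_vector_derivative d) (at t within I)"
  shows "tderiv I f t = d"
  unfolding tderiv_def
  using vector_derivative_within[OF interval_point_not_isolated] assms by blast

text \<open>The value of \<^const>\<open>vector_derivative\<close> says nothing at points of non-differentiability and at
  isolated points. On a nondegenerate interval, differentiability together with a prescribed value is
  the same as the relational notion, for which derivative rules compose.\<close>

lemma differentiable_tderiv_iff:
  assumes "is_interval I" and "interior I \<noteq> {}"
  shows "f differentiable_on I \<and> (\<forall>t\<in>I. tderiv I f t = d t) \<longleftrightarrow>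
    (\<forall>t\<in>I. (f has_vector_derivative d t) (at t within I))"
  using tderiv_eqI[OF assms, of _ f] vector_derivative_works[of f]
  unfolding differentiable_on_def tderiv_def
  by (metis differentiableI_vector)

lemma system_solution_iff:
  assumes "is_interval I" and "interior I \<noteq> {}"
  shows "system_solution I \<Sigma> u x y \<longleftrightarrow> continuous_on I u \<and>
    (\<forall>t\<in>I. (x has_vector_derivative sysA \<Sigma> *v x t + sysB \<Sigma> *v u t) (at t within I)) \<and>
    (\<forall>t\<in>I. y t = sysC \<Sigma> *v x t + sysD \<Sigma> *v u t)"
  unfolding differentiable_tderiv_iff[OF assms, symmetric] system_solution_def by blast

lemma system_solution_state_cong:
  assumes "is_interval I" and "interior I \<noteq> {}" and eq: "\<And>t. t \<in> I \<Longrightarrow> x t = x' t"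
  shows "system_solution I \<Sigma> u x y \<longleftrightarrow> system_solution I \<Sigma> u x' y"
proof -
  have "(x has_vector_derivative d) (at t within I) \<longleftrightarrow> (x' has_vector_derivative d) (at t within I)"
    if "t \<in> I" for t d
    by (rule iffI; rule has_vector_derivative_transform[OF that]) (simp_all add: eq)
  then show ?thesis using eq by (auto simp: system_solution_iff[OF assms(1,2)])
qed

lemma system_solution_energy_rate:
  assumes "is_interval I" and "interior I \<noteq> {}"
    and "system_solution I \<Sigma> u x y" and "t \<in> I"
  shows "tderiv I (\<lambda>s. (norm (x s))\<^sup>2) t = 2 * (x t \<bullet> (sysA \<Sigma> *v x t + sysB \<Sigma> *v u t))"
proof (rule tderiv_eqI)
  have "(x has_vector_derivative sysA \<Sigma> *v x t + sysB \<Sigma> *v u t) (at t within I)"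
    using assms by (simp add: system_solution_iff)
  from bounded_bilinear.has_vector_derivative[OF bounded_bilinear_inner this this]
  show "((\<lambda>s. (norm (x s))\<^sup>2) has_vector_derivative
      2 * (x t \<bullet> (sysA \<Sigma> *v x t + sysB \<Sigma> *v u t))) (at t within I)"
    by (simp add: power2_norm_eq_inner inner_commute)
qed fact+

text \<open>A constant input already lets the pair of state and input take any prescribed value at a
  prescribed time.\<close>

lemma system_solution_through_point:
  assumes "is_interval I" and "interior I \<noteq> {}" and "t \<in> I"
  obtains x y where "system_solution I \<Sigma> (\<lambda>_. u0) x y" "x t = x0"
proof -
  obtain x where x: "x t = x0" "\<And>t. (x has_vector_derivative sysA \<Sigma> *v x t + sysB \<Sigma> *v u0) (at t)"
    using linear_ode_solution_exists by blast
  then have "system_solution I \<Sigma> (\<lambda>_. u0) x (\<lambda>t. sysC \<Sigma> *v x t + sysD \<Sigma> *v u0)"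
    using assms by (auto simp: system_solution_iff intro: has_vector_derivative_at_within)
  then show thesis using x that by blast
qed

text \<open>The energy rate and the supplied power at time \<open>t\<close> depend only on \<open>x t\<close> and \<open>u t\<close>, and every
  pair of values occurs on some trajectory. Hence a condition on all trajectories is a condition on
  all pairs of vectors. The relation \<open>R\<close> covers passivity and conservativity at once.\<close>

lemma energy_balance_pointwise:
  assumes "is_interval I" and "interior I \<noteq> {}"
  shows "(\<forall>u x y. system_solution I \<Sigma> u x y \<longrightarrow>
        (\<forall>t\<in>I. R (tderiv I (\<lambda>s. (norm (x s))\<^sup>2) t) (2 * (u t \<bullet> y t)))) \<longleftrightarrow>
    (\<forall>x u. R (2 * (x \<bullet> (sysA \<Sigma> *v x + sysB \<Sigma> *v u))) (2 * (u \<bullet> (sysC \<Sigma> *v x + sysD \<Sigma> *v u))))"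
    (is "?trajectories \<longleftrightarrow> ?points")
proof
  assume points: ?points
  show ?trajectories
  proof (intro allI impI ballI)
    fix u x y t
    assume sol: "system_solution I \<Sigma> u x y" and "t \<in> I"
    then have "y t = sysC \<Sigma> *v x t + sysD \<Sigma> *v u t" by (simp add: system_solution_def)
    then show "R (tderiv I (\<lambda>s. (norm (x s))\<^sup>2) t) (2 * (u t \<bullet> y t))"
      using points system_solution_energy_rate[OF assms sol \<open>t \<in> I\<close>] by simp
  qed
next
  assume traj: ?trajectories
  obtain t where "t \<in> I" using assms(2) interior_subset by blast
  show ?points
  proof (intro allI)
    fix x0 u0
    obtain x y where sol: "system_solution I \<Sigma> (\<lambda>_. u0) x y" and "x t = x0"
      using system_solution_through_point[OF assms \<open>t \<in> I\<close>] by blast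
    moreover have "y t = sysC \<Sigma> *v x t + sysD \<Sigma> *v u0"
      using sol \<open>t \<in> I\<close> by (simp add: system_solution_def)
    ultimately show "R (2 * (x0 \<bullet> (sysA \<Sigma> *v x0 + sysB \<Sigma> *v u0))) (2 * (u0 \<bullet> (sysC \<Sigma> *v x0 + sysD \<Sigma> *v u0)))"
      using traj \<open>t \<in> I\<close> system_solution_energy_rate[OF assms sol \<open>t \<in> I\<close>] by metis
  qed
qed

lemma impedance_passive_iff:
  assumes "is_interval I" and "interior I \<noteq> {}"
  shows "impedance_passive I \<Sigma> \<longleftrightarrow>
    (\<forall>x u. x \<bullet> (sysA \<Sigma> *v x + sysB \<Sigma> *v u) \<le> u \<bullet> (sysC \<Sigma> *v x + sysD \<Sigma> *v u))"
  unfolding impedance_passive_def energy_balance_pointwise[OF assms, where R = "(\<le>)"] by simp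

lemma impedance_conservative_iff:
  assumes "is_interval I" and "interior I \<noteq> {}"
  shows "impedance_conservative I \<Sigma> \<longleftrightarrow>
    (\<forall>x u. x \<bullet> (sysA \<Sigma> *v x + sysB \<Sigma> *v u) = u \<bullet> (sysC \<Sigma> *v x + sysD \<Sigma> *v u))"
  unfolding impedance_conservative_def energy_balance_pointwise[OF assms, where R = "(=)"] by simp

section \<open>Block vectors and block matrices\<close>

lemma vstack_cases:
  fixes x :: "'a^('m::finite + 'n::finite)"
  obtains v w where "x = vstack v w"
proof (rule that)
  show "x = vstack (\<chi> i. x $ Inl i) (\<chi> i. x $ Inr i)"
    by (auto simp: vstack_def vec_eq_iff split: sum.split)
qed

lemma vstack_eq_iff: "vstack v w = vstack v' w' \<longleftrightarrow> v = v' \<and> w = w'"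
  by (auto simp: vstack_def vec_eq_iff split: sum.splits)

lemma vstack_add: "vstack v w + vstack v' w' = vstack (v + v') (w + w')"
  by (auto simp: vstack_def vec_eq_iff split: sum.split)

lemma vstack_scaleR: "c *\<^sub>R vstack v w = vstack (c *\<^sub>R v) (c *\<^sub>R w)"
  by (auto simp: vstack_def vec_eq_iff split: sum.split)

lemma sum_UNIV_Plus:
  fixes f :: "'a::finite + 'b::finite \<Rightarrow> 'c::comm_monoid_add"
  shows "sum f UNIV = (\<Sum>i\<in>UNIV. f (Inl i)) + (\<Sum>j\<in>UNIV. f (Inr j))"
  by (simp add: UNIV_Plus_UNIV[symmetric] sum.Plus del: UNIV_Plus_UNIV)

lemma vstack_inner: "vstack v w \<bullet> vstack v' w' = v \<bullet> v' + w \<bullet> w'"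
  by (simp add: inner_vec_def sum_UNIV_Plus vstack_def)

lemma vstack_mult: "vstack S T *v x = vstack (S *v x) (T *v x)"
  by (auto simp: vstack_def matrix_vector_mult_def vec_eq_iff split: sum.split)

lemma hstack_mult: "hstack S T *v vstack v w = S *v v + T *v w"
  by (simp add: hstack_def vstack_def matrix_vector_mult_def vec_eq_iff sum_UNIV_Plus)

lemma scaleR_matrix_vector_mult: "(c *\<^sub>R A) *v x = c *\<^sub>R (A *v (x :: real^'n))"
  by (simp add: scaleR_matrix_vector_assoc)

lemma uminus_matrix_vector_mult: "(- A) *v x = - (A *v (x :: real^'n))"
  by (simp add: matrix_vector_mult_def vec_eq_iff sum_negf)

section \<open>Derivatives under invertible linear changes of coordinates\<close>

text \<open>The equivalences of this section, rather than mere implications, are what allows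
  differentiability of \<open>z'\<close> to be read off from differentiability of the state.\<close>

lemma has_vector_derivative_vstack_iff:
  fixes v :: "real \<Rightarrow> real^'m" and w :: "real \<Rightarrow> real^'n"
  shows "((\<lambda>s. vstack (v s) (w s)) has_vector_derivative vstack v' w') (at t within I) \<longleftrightarrow>
    (v has_vector_derivative v') (at t within I) \<and> (w has_vector_derivative w') (at t within I)"
    (is "(?x has_vector_derivative _) _ \<longleftrightarrow> _")
proof
  assume x: "(?x has_vector_derivative vstack v' w') (at t within I)"
  let ?P = "hstack (mat 1) 0 :: real^('m + 'n)^'m" and ?Q = "hstack 0 (mat 1) :: real^('m + 'n)^'n"
  have "bounded_linear ((*v) ?P)" "bounded_linear ((*v) ?Q)" by simp_all
  from this[THEN bounded_linear.has_vector_derivative, OF x]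
  show "(v has_vector_derivative v') (at t within I) \<and> (w has_vector_derivative w') (at t within I)"
    by (simp add: hstack_mult)
next
  assume vw: "(v has_vector_derivative v') (at t within I) \<and> (w has_vector_derivative w') (at t within I)"
  let ?P = "vstack (mat 1) 0 :: real^'m^('m + 'n)" and ?Q = "vstack 0 (mat 1) :: real^'n^('m + 'n)"
  have "bounded_linear ((*v) ?P)" "bounded_linear ((*v) ?Q)" by simp_all
  note this[THEN bounded_linear.has_vector_derivative]
  with vw have "((\<lambda>s. ?P *v v s + ?Q *v w s) has_vector_derivative ?P *v v' + ?Q *v w') (at t within I)"
    by (intro has_vector_derivative_add) auto
  then show "(?x has_vector_derivative vstack v' w') (at t within I)"
    by (simp add: vstack_mult vstack_add)
qed

lemma has_vector_derivative_matrix_iff: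
  fixes f :: "real \<Rightarrow> real^'n" and A :: "real^'n^'m" and B :: "real^'m^'n"
  assumes BA: "\<And>v. B *v (A *v v) = v"
  shows "((\<lambda>s. A *v f s) has_vector_derivative A *v d) (at t within I) \<longleftrightarrow>
    (f has_vector_derivative d) (at t within I)"
proof
  assume "((\<lambda>s. A *v f s) has_vector_derivative A *v d) (at t within I)"
  from bounded_linear.has_vector_derivative[OF matrix_vector_mul_bounded_linear[of B] this]
  show "(f has_vector_derivative d) (at t within I)" by (simp add: BA)
qed (simp add: bounded_linear.has_vector_derivative)

lemma has_vector_derivative_scaleR_iff:
  fixes c :: real
  assumes "c \<noteq> 0"
  shows "((\<lambda>s. c *\<^sub>R f s) has_vector_derivative c *\<^sub>R d) (at t within I) \<longleftrightarrow>
    (f has_vector_derivative d) (at t within I)"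
proof
  assume "((\<lambda>s. c *\<^sub>R f s) has_vector_derivative c *\<^sub>R d) (at t within I)"
  from bounded_linear.has_vector_derivative[OF bounded_linear_scaleR_right[of "inverse c"] this]
  show "(f has_vector_derivative d) (at t within I)" using assms by simp
qed (simp add: bounded_linear.has_vector_derivative bounded_linear_scaleR_right)

section \<open>The second order system in energy coordinates\<close>

lemma second_order_vector_field:
  "sysA (second_order_system M P K F Q1 Q2) *v vstack v w + sysB (second_order_system M P K F Q1 Q2) *v u =
    vstack (mat_sqrt K *v (mat_inv_sqrt M *v w))
      (mat_inv_sqrt M *v ((1 / sqrt 2) *\<^sub>R (F *v u) - mat_sqrt K *v v - P *v (mat_inv_sqrt M *v w)))"
  by (simp add: second_order_system_def vstack_mult hstack_mult vstack_add vstack_scaleR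
      scaleR_matrix_vector_mult matrix_vector_mul_assoc[symmetric] matrix_vector_mult_diff_distrib
      matrix_vector_mult_scaleR vstack_eq_iff uminus_matrix_vector_mult)

lemma second_order_output:
  "sysC (second_order_system M P K F Q1 Q2) *v vstack v w + sysD (second_order_system M P K F Q1 Q2) *v u =
    sqrt 2 *\<^sub>R (Q1 *v (mat_inv_sqrt K *v v) + Q2 *v (mat_inv_sqrt M *v w))"
  by (simp add: second_order_system_def hstack_mult scaleR_matrix_vector_mult
      matrix_vector_mul_assoc[symmetric])

text \<open>The upper half of the state equation says that \<open>K^(1/2) z\<close> has derivative \<open>K^(1/2) z'\<close>, which holds for any
  differentiable \<open>z\<close>. The lower half, multiplied by \<open>\<surd>2 M^(1/2)\<close>, is the second order
  equation.\<close>

lemma second_order_solution_iff_system_solution: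
  fixes M P K :: "real^'m^'m"
  assumes I: "is_interval I" "interior I \<noteq> {}"
    and M: "psd M" "invertible M" and K: "psd K" "invertible K"
    and z: "z differentiable_on I"
  shows "second_order_solution I M P K F Q1 Q2 u z y \<longleftrightarrow>
    system_solution I (second_order_system M P K F Q1 Q2) u (second_order_state I M K z) y"
proof -
  note inv = mat_inv_sqrt[OF M] mat_inv_sqrt[OF K]
  define c :: real where "c = 1 / sqrt 2"
  have c: "c \<noteq> 0" "sqrt 2 * c = 1" by (simp_all add: c_def)
  define L N where "L = mat_sqrt K" and "N = mat_sqrt M"
  define z' where "z' = tderiv I z"
  have LL: "L *v (L *v v) = K *v v" and NN: "N *v (N *v v) = M *v v" for v
    using mat_sqrt(2)[OF K(1)] mat_sqrt(2)[OF M(1)]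
    by (simp_all add: L_def N_def matrix_vector_mul_assoc)
  let ?a = "\<lambda>t. mat_inv_sqrt M *v (mat_inv_sqrt M *v (F *v u t - K *v z t - P *v z' t))"
  have state: "second_order_state I M K z = (\<lambda>t. vstack (c *\<^sub>R (L *v z t)) (c *\<^sub>R (N *v z' t)))"
    by (simp add: second_order_state_def vstack_scaleR c_def L_def N_def z'_def fun_eq_iff)
  have rhs: "sysA (second_order_system M P K F Q1 Q2) *v second_order_state I M K z t
      + sysB (second_order_system M P K F Q1 Q2) *v u t =
      vstack (c *\<^sub>R (L *v z' t)) (c *\<^sub>R (N *v ?a t))" for t
    unfolding state second_order_vector_field
    using inv LL by (simp add: c_def[symmetric] L_def[symmetric] N_def[symmetric] vstack_eq_iff
        matrix_vector_mult_scaleR matrix_vector_mult_diff_distrib scaleR_right_diff_distrib)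
  have out: "sysC (second_order_system M P K F Q1 Q2) *v second_order_state I M K z t
      + sysD (second_order_system M P K F Q1 Q2) *v u t = Q1 *v z t + Q2 *v z' t" for t
    unfolding state second_order_output
    using inv c by (simp add: L_def[symmetric] N_def[symmetric] matrix_vector_mult_scaleR scaleR_right_distrib)
  have z': "(z has_vector_derivative z' t) (at t within I)" if "t \<in> I" for t
    using z that differentiable_tderiv_iff[OF I, of z z'] by (simp add: z'_def)
  have ode: "((second_order_state I M K z) has_vector_derivative
      sysA (second_order_system M P K F Q1 Q2) *v second_order_state I M K z t
      + sysB (second_order_system M P K F Q1 Q2) *v u t) (at t within I) \<longleftrightarrow>
      (z' has_vector_derivative ?a t) (at t within I)" if "t \<in> I" for t
  proof -
    have "((\<lambda>s. N *v z' s) has_vector_derivative N *v ?a t) (at t within I) \<longleftrightarrow>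
        (z' has_vector_derivative ?a t) (at t within I)"
      by (rule has_vector_derivative_matrix_iff[where B = "mat_inv_sqrt M"]) (simp add: N_def inv)
    moreover have "((\<lambda>s. L *v z s) has_vector_derivative L *v z' t) (at t within I)"
      using z'[OF that] by (simp add: bounded_linear.has_vector_derivative)
    ultimately show ?thesis
      unfolding rhs unfolding state
      by (simp add: has_vector_derivative_vstack_iff has_vector_derivative_scaleR_iff[OF c(1)])
  qed
  have newton: "M *v d + P *v z' t + K *v z t = F *v u t \<longleftrightarrow> d = ?a t" for d t
  proof -
    have "M *v d + P *v z' t + K *v z t = F *v u t \<longleftrightarrow>
        N *v (N *v d) = F *v u t - K *v z t - P *v z' t"
      by (auto simp: NN algebra_simps)
    also have "\<dots> \<longleftrightarrow> d = ?a t" using inv by (metis N_def)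
    finally show ?thesis .
  qed
  show ?thesis
    unfolding second_order_solution_def system_solution_iff[OF I] out
    using z by (simp add: z'_def[symmetric] newton ode flip: differentiable_tderiv_iff[OF I]) blast
qed

text \<open>The position is recovered from the upper half \<open>v\<close> of the state as \<open>\<surd>2 K^(-1/2) v\<close>, and the upper
  half of the state equation shows that its velocity is \<open>\<surd>2 M^(-1/2) w\<close>, with \<open>w\<close> the lower half.\<close>

lemma system_solution_imp_second_order:
  fixes M P K :: "real^'m^'m"
  assumes I: "is_interval I" "interior I \<noteq> {}"
    and M: "psd M" "invertible M" and K: "psd K" "invertible K"
    and sol: "system_solution I (second_order_system M P K F Q1 Q2) u x y"
  obtains z where "second_order_solution I M P K F Q1 Q2 u z y"
    "\<And>t. t \<in> I \<Longrightarrow> x t = second_order_state I M K z t"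
proof -
  note inv = mat_inv_sqrt[OF M] mat_inv_sqrt[OF K]
  have "\<forall>t. \<exists>v w. x t = vstack v w"
    by (meson vstack_cases)
  then obtain v w where x: "x = (\<lambda>t. vstack (v t) (w t))" by metis
  define z where "z t = sqrt 2 *\<^sub>R (mat_inv_sqrt K *v v t)" for t
  have "(z has_vector_derivative sqrt 2 *\<^sub>R (mat_inv_sqrt M *v w t)) (at t within I)" if "t \<in> I" for t
  proof -
    have "(v has_vector_derivative mat_sqrt K *v (mat_inv_sqrt M *v w t)) (at t within I)"
      using sol that unfolding x
      by (simp add: system_solution_iff[OF I] second_order_vector_field has_vector_derivative_vstack_iff)
    from bounded_linear.has_vector_derivative[OF matrix_vector_mul_bounded_linear[of "mat_inv_sqrt K"] this]
    show ?thesis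
      unfolding z_def using inv by (simp add: has_vector_derivative_scaleR_iff)
  qed
  then have z: "z differentiable_on I" "\<And>t. t \<in> I \<Longrightarrow> tderiv I z t = sqrt 2 *\<^sub>R (mat_inv_sqrt M *v w t)"
    using differentiable_tderiv_iff[OF I, of z "\<lambda>t. sqrt 2 *\<^sub>R (mat_inv_sqrt M *v w t)"] by auto
  then have eq: "x t = second_order_state I M K z t" if "t \<in> I" for t
    using that inv by (simp add: x second_order_state_def z_def matrix_vector_mult_scaleR vstack_scaleR)
  then have "system_solution I (second_order_system M P K F Q1 Q2) u (second_order_state I M K z) y"
    using sol system_solution_state_cong[OF I, of x "second_order_state I M K z"] by blast
  then have "second_order_solution I M P K F Q1 Q2 u z y"
    using second_order_solution_iff_system_solution[OF I M K z(1)] by blast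
  then show thesis using eq that by blast
qed

section \<open>The power balance as an inequality between quadratic forms\<close>

text \<open>In the coordinates \<open>x = (K^(1/2) a, M^(1/2) b) / \<surd>2\<close>, in which \<open>a\<close> is a position and \<open>b\<close> a velocity, the two
  off-diagonal blocks exchange potential and kinetic energy without loss, so all square roots cancel
  from the power balance. Both roots being invertible, \<open>a\<close> and \<open>b\<close> range over all vectors.\<close>

lemma second_order_power_balance:
  fixes M P K :: "real^'m^'m"
  assumes M: "psd M" "invertible M" and K: "psd K" "invertible K"
  shows "(\<forall>x u. R (x \<bullet> (sysA (second_order_system M P K F Q1 Q2) *v x + sysB (second_order_system M P K F Q1 Q2) *v u))
      (u \<bullet> (sysC (second_order_system M P K F Q1 Q2) *v x + sysD (second_order_system M P K F Q1 Q2) *v u))) \<longleftrightarrow>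
    (\<forall>a b u. R ((b \<bullet> (F *v u) - b \<bullet> (P *v b)) / 2) (u \<bullet> (Q1 *v a + Q2 *v b)))"
    (is "?lhs \<longleftrightarrow> ?rhs")
proof -
  note inv = mat_inv_sqrt[OF M] mat_inv_sqrt[OF K]
  define c :: real where "c = 1 / sqrt 2"
  have c: "sqrt 2 * c = 1" "c * c = 1 / 2" by (simp_all add: c_def)
  let ?x = "\<lambda>a b. vstack (c *\<^sub>R (mat_sqrt K *v a)) (c *\<^sub>R (mat_sqrt M *v b))"
  have surj: "\<exists>a b. x = ?x a b" for x
  proof -
    obtain v w where "x = vstack v w" by (rule vstack_cases)
    then have "x = ?x (sqrt 2 *\<^sub>R (mat_inv_sqrt K *v v)) (sqrt 2 *\<^sub>R (mat_inv_sqrt M *v w))"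
      using inv c by (simp add: matrix_vector_mult_scaleR mult.commute)
    then show ?thesis by blast
  qed
  have power: "?x a b \<bullet> (sysA (second_order_system M P K F Q1 Q2) *v ?x a b + sysB (second_order_system M P K F Q1 Q2) *v u)
      = (b \<bullet> (F *v u) - b \<bullet> (P *v b)) / 2" for a b u
  proof -
    have "?x a b \<bullet> (sysA (second_order_system M P K F Q1 Q2) *v ?x a b + sysB (second_order_system M P K F Q1 Q2) *v u)
      = c * c * ((mat_sqrt K *v a) \<bullet> (mat_sqrt K *v b) + b \<bullet> (F *v u) -
          b \<bullet> (mat_sqrt K *v (mat_sqrt K *v a)) - b \<bullet> (P *v b))"
      unfolding second_order_vector_field
      using inv by (simp add: vstack_inner psd_inner[OF mat_sqrt(1)[OF M(1)]] matrix_vector_mult_scaleR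
          inner_diff_right c_def[symmetric] algebra_simps)
    \<comment> \<open>The flows of energy from position to velocity and back are equal, as the root of \<open>K\<close> is symmetric.\<close>
    also have "b \<bullet> (mat_sqrt K *v (mat_sqrt K *v a)) = (mat_sqrt K *v a) \<bullet> (mat_sqrt K *v b)"
      by (metis psd_inner[OF mat_sqrt(1)[OF K(1)]] inner_commute)
    finally show ?thesis using c by simp
  qed
  have out: "sysC (second_order_system M P K F Q1 Q2) *v ?x a b + sysD (second_order_system M P K F Q1 Q2) *v u
      = Q1 *v a + Q2 *v b" for a b u
    unfolding second_order_output
    using inv c by (simp add: matrix_vector_mult_scaleR scaleR_right_distrib)
  show ?thesis
  proof
    assume lhs: ?lhs
    show ?rhs
    proof (intro allI)
      fix a b u
      show "R ((b \<bullet> (F *v u) - b \<bullet> (P *v b)) / 2) (u \<bullet> (Q1 *v a + Q2 *v b))"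
        using lhs[rule_format, of "?x a b" u] unfolding power out .
    qed
  next
    assume rhs: ?rhs
    show ?lhs
    proof (intro allI)
      fix x u
      obtain a b where x: "x = ?x a b" using surj by blast
      show "R (x \<bullet> (sysA (second_order_system M P K F Q1 Q2) *v x + sysB (second_order_system M P K F Q1 Q2) *v u))
          (u \<bullet> (sysC (second_order_system M P K F Q1 Q2) *v x + sysD (second_order_system M P K F Q1 Q2) *v u))"
        unfolding x power out using rhs by blast
    qed
  qed
qed

lemma linear_le_bounded_imp_zero:
  fixes d :: real
  assumes "\<And>s. s * d \<le> e"
  shows "d = 0"
proof (rule ccontr)
  assume "d \<noteq> 0"
  then show False using assms[of "(\<bar>e\<bar> + 1) / d"] by simp
qed

lemma matrix_zero_if_form_zero:
  fixes A :: "real^'n^'m"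
  assumes "\<And>u a. u \<bullet> (A *v a) = 0"
  shows "A = 0"
proof -
  have "A *v a = 0" for a using assms[of "A *v a" a] by simp
  then show ?thesis by (simp add: matrix_eq)
qed

lemma inner_matrix_transpose: "b \<bullet> (A *v u) = u \<bullet> (transpose A *v b)"
  for A :: "real^'k^'m"
  by (metis dot_lmul_matrix inner_commute transpose_matrix_vector)

text \<open>A linear functional that is bounded on one side vanishes. At velocity \<open>b = 0\<close> the inequality
  bounds \<open>u \<bullet> Q1 a\<close>, which is linear in \<open>a\<close>. At position \<open>a = 0\<close> it bounds
  \<open>u \<bullet> (F\<^sup>T / 2 - Q2) b\<close>, which is linear in \<open>u\<close>, by \<open>(b \<bullet> P b) / 2\<close>, in which \<open>u\<close> does not
  occur.\<close>

lemma dissipation_iff: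
  fixes P :: "real^'m^'m" and F :: "real^'k^'m" and Q1 Q2 :: "real^'m^'k"
  assumes "psd P"
  shows "(\<forall>a b u. (b \<bullet> (F *v u) - b \<bullet> (P *v b)) / 2 \<le> u \<bullet> (Q1 *v a + Q2 *v b)) \<longleftrightarrow>
    Q1 = 0 \<and> Q2 = (1 / 2) *\<^sub>R transpose F" (is "?ineq \<longleftrightarrow> ?collocated")
proof -
  note adjoint = inner_matrix_transpose[of _ F]
  show ?thesis
  proof
    assume ?collocated
    then show ?ineq
      using assms by (auto simp: adjoint scaleR_matrix_vector_mult psd_def)
  next
    assume ineq: ?ineq
    have "u \<bullet> (Q1 *v a) = 0" for u a
    proof (rule linear_le_bounded_imp_zero)
      have "0 \<le> s * (u \<bullet> (Q1 *v a))" for s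
        using ineq[rule_format, of 0 u "s *\<^sub>R a"] by (simp add: matrix_vector_mult_scaleR)
      from this[of "- s" for s] show "s * (u \<bullet> (Q1 *v a)) \<le> 0" for s by simp
    qed
    then have "Q1 = 0" by (rule matrix_zero_if_form_zero)
    moreover have "u \<bullet> (((1 / 2) *\<^sub>R transpose F - Q2) *v b) = 0" for u b
    proof (rule linear_le_bounded_imp_zero)
      show "s * (u \<bullet> (((1 / 2) *\<^sub>R transpose F - Q2) *v b)) \<le> (b \<bullet> (P *v b)) / 2" for s
        using ineq[rule_format, of b "s *\<^sub>R u" 0]
        by (simp add: adjoint matrix_vector_mult_diff_rdistrib scaleR_matrix_vector_mult
            inner_diff_right field_simps)
    qed
    then have "(1 / 2) *\<^sub>R transpose F - Q2 = 0" by (rule matrix_zero_if_form_zero)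
    ultimately show ?collocated by simp
  qed
qed

text \<open>Equality contains the inequality; at zero input and zero position it forces the form of \<open>P\<close> to
  vanish, and then \<open>P\<close> itself, as \<open>P\<close> is positive semidefinite.\<close>

lemma conservation_iff:
  fixes P :: "real^'m^'m" and F :: "real^'k^'m" and Q1 Q2 :: "real^'m^'k"
  assumes "psd P"
  shows "(\<forall>a b u. (b \<bullet> (F *v u) - b \<bullet> (P *v b)) / 2 = u \<bullet> (Q1 *v a + Q2 *v b)) \<longleftrightarrow>
    P = 0 \<and> Q1 = 0 \<and> Q2 = (1 / 2) *\<^sub>R transpose F" (is "?eq \<longleftrightarrow> _ \<and> ?collocated")
proof
  assume eq: ?eq
  then have ?collocated using dissipation_iff[OF assms, of F Q1 Q2] by (metis order_refl)
  have "b \<bullet> (P *v b) = 0" for b using eq[rule_format, of b 0 0] by simp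
  then have "P = 0"
    using psd_kernel[OF assms] by (simp add: matrix_eq)
  with \<open>?collocated\<close> show "P = 0 \<and> ?collocated" by simp
next
  assume "P = 0 \<and> ?collocated"
  then show ?eq by (auto simp: scaleR_matrix_vector_mult inner_matrix_transpose[of _ F])
qed

section \<open>Realisation, passivity and conservativity\<close>

theorem theorem2:
  fixes M P K :: "real^'m^'m" and F :: "real^'k^'m" and Q1 Q2 :: "real^'m^'k"
    and I :: "real set"
  assumes "is_interval I" and "interior I \<noteq> {}"
    and "psd M" and "psd P" and "psd K"
    and "invertible M" and "invertible K"
  shows "(\<forall>u z y. z differentiable_on I \<longrightarrow>
             (second_order_solution I M P K F Q1 Q2 u z y \<longleftrightarrow>
              system_solution I (second_order_system M P K F Q1 Q2) u
                (second_order_state I M K z) y)) \<and>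
         (\<forall>u x y. system_solution I (second_order_system M P K F Q1 Q2) u x y \<longrightarrow>
             (\<exists>z. second_order_solution I M P K F Q1 Q2 u z y \<and>
                  (\<forall>t\<in>I. x t = second_order_state I M K z t))) \<and>
         (impedance_passive I (second_order_system M P K F Q1 Q2) \<longleftrightarrow>
            Q1 = 0 \<and> Q2 = (1 / 2) *\<^sub>R transpose F) \<and>
         (impedance_conservative I (second_order_system M P K F Q1 Q2) \<longleftrightarrow>
            P = 0 \<and> Q1 = 0 \<and> Q2 = (1 / 2) *\<^sub>R transpose F)"
proof -
  note I = assms(1,2) and M = \<open>psd M\<close> \<open>invertible M\<close> and K = \<open>psd K\<close> \<open>invertible K\<close>
  note pointwise = second_order_power_balance[OF M K]
  show ?thesis
    unfolding impedance_passive_iff[OF I] impedance_conservative_iff[OF I]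
      pointwise[where R = "(\<le>)"] pointwise[where R = "(=)"]
      dissipation_iff[OF \<open>psd P\<close>] conservation_iff[OF \<open>psd P\<close>]
  proof (intro conjI allI impI)
    fix u :: "real \<Rightarrow> real^'k" and z :: "real \<Rightarrow> real^'m" and y
    assume "z differentiable_on I"
    with second_order_solution_iff_system_solution[OF I M K]
    show "second_order_solution I M P K F Q1 Q2 u z y \<longleftrightarrow>
        system_solution I (second_order_system M P K F Q1 Q2) u (second_order_state I M K z) y" .
  next
    fix u x y
    assume "system_solution I (second_order_system M P K F Q1 Q2) u x y"
    then obtain z where "second_order_solution I M P K F Q1 Q2 u z y"
      "\<And>t. t \<in> I \<Longrightarrow> x t = second_order_state I M K z t"
      using system_solution_imp_second_order[OF I M K] by blast
    then show "\<exists>z. second_order_solution I M P K F Q1 Q2 u z y \<and>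
        (\<forall>t\<in>I. x t = second_order_state I M K z t)" by blast
  qed (rule refl)+
qed

end
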